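(* Let $G$ be a simple graph of order $n$ and let $k$ be an integer with $1\le k\le n-1$. Suppose $\nu(G)=\lfloor n/2\rfloor$. Then: (1) if $n$ is even and $k$ is odd, $\nu(F_k(G))=\binom{n}{k}/2$; (2) if $n$ is even and $k$ is even, $\nu(F_k(G))\ge \big(\binom{n}{k}-\binom{n/2}{k/2}\big)/2$; (3) if $n$ is odd, $\nu(F_k(G))\ge \big(\binom{n}{k}-\binom{(n-1)/2}{\lfloor k/2\rfloor}\big)/2$. Moreover, if $G$ itself is a perfect matching (i.e. $n$ is even and $G$ consists of $n/2$ pairwise disjoint edges), then equality holds in (2); and if $G$ itself is an almost perfect matching (i.e. $n$ is odd and $G$ consists of $(n-1)/2$ pairwise disjoint edges together with one isolated vertex), then equality holds in (3).
   Context: For a simple finite graph $G$ of order $n$ and an integer $1\le k\le n-1$, the $k$-token graph $F_k(G)$ is the graph whose vertices are all $k$-element subsets of $V(G)$, two such subsets $A,B$ being adjacent iff their symmetric difference $A\triangle B$ is an edge of $G$. $\nu(H)$ denotes the matching number of a graph $H$ (the maximum number of edges in a matching). *)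

theory Defs
  imports Complex_Main "HOL-Library.Ramsey"
begin

type_synonym 'a ugraph = "'a set \<times> 'a set set"

abbreviation verts :: "'a ugraph \<Rightarrow> 'a set" where
  "verts G \<equiv> fst G"

abbreviation edges :: "'a ugraph \<Rightarrow> 'a set set" where
  "edges G \<equiv> snd G"

definition simple_graph :: "'a ugraph \<Rightarrow> bool" where
  "simple_graph G \<longleftrightarrow> finite (verts G) \<and> edges G \<subseteq> [verts G]\<^bsup>2\<^esup>"

(* If G is simple, then {} is not an edge of G, so the condition on the
   symmetric difference forces A and B to be distinct. *)
definition token_graph :: "nat \<Rightarrow> 'a ugraph \<Rightarrow> 'a set ugraph" where
  "token_graph k G =
    ([verts G]\<^bsup>k\<^esup>,
     {{A, B} | A B. A \<in> [verts G]\<^bsup>k\<^esup> \<and> B \<in> [verts G]\<^bsup>k\<^esup> \<and> sym_diff A B \<in> edges G})"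

definition matching :: "'a ugraph \<Rightarrow> 'a set set \<Rightarrow> bool" where
  "matching G M \<longleftrightarrow> M \<subseteq> edges G \<and> pairwise disjnt M"

definition matching_number :: "'a ugraph \<Rightarrow> nat" where
  "matching_number G = Max (card ` {M. matching G M})"

definition is_perfect_matching :: "'a ugraph \<Rightarrow> bool" where
  "is_perfect_matching G \<longleftrightarrow>
    even (card (verts G)) \<and> pairwise disjnt (edges G) \<and>
    card (edges G) = card (verts G) div 2 \<and> \<Union>(edges G) = verts G"

definition is_almost_perfect_matching :: "'a ugraph \<Rightarrow> bool" where
  "is_almost_perfect_matching G \<longleftrightarrow>
    odd (card (verts G)) \<and> pairwise disjnt (edges G) \<and>
    card (edges G) = (card (verts G) - 1) div 2 \<and>
    (\<exists>v \<in> verts G. \<Union>(edges G) = verts G - {v})"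

lemma simple_graph_token_graph:
  assumes "simple_graph G"
  shows "simple_graph (token_graph k G)"
proof -
  have "A \<noteq> B" if "sym_diff A B \<in> edges G" for A B
    using that assms by (auto simp: simple_graph_def nsets_def)
  moreover have "finite ([verts G]\<^bsup>k\<^esup>)"
    using assms by (simp add: simple_graph_def finite_imp_finite_nsets)
  ultimately show ?thesis
    by (fastforce simp: simple_graph_def token_graph_def nsets_def[of _ 2])
qed

lemma finite_matchings:
  assumes "simple_graph G"
  shows "finite {M. matching G M}"
proof -
  have "finite (edges G)"
    using assms finite_imp_finite_nsets finite_subset by (auto simp: simple_graph_def)
  then show ?thesis
    by (rule finite_subset[rotated, OF finite_Pow_iff[THEN iffD2]]) (auto simp: matching_def)
qed

end

theory Submission
  imports Defs
begin

text \<open>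
  Let \<open>M\<close> be a maximum matching of \<open>G\<close>. An edge \<open>e \<in> M\<close> crosses a set \<open>A\<close> if exactly one endpoint
  of \<open>e\<close> lies in \<open>A\<close>; moving the token along \<open>e\<close> replaces \<open>A\<close> by the symmetric difference of \<open>A\<close>
  and \<open>e\<close>, which is crossed by the same edges of \<open>M\<close>. Hence moving the token along an edge chosen as
  a function of the set of crossing edges is a fixed-point-free involution, i.e. a perfect matching,
  on the \<open>k\<close>-sets crossed by at least one edge of \<open>M\<close>. The remaining \<open>k\<close>-sets are unions of
  \<open>k div 2\<close> edges of \<open>M\<close> and of \<open>k mod 2\<close> of the \<open>n mod 2\<close> vertices missed by \<open>M\<close>. If \<open>M\<close> contains
  all edges of \<open>G\<close>, these uncrossed \<open>k\<close>-sets are isolated in the token graph.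
\<close>

lemma finite_verts:
  assumes "simple_graph H"
  shows "finite (verts H)"
  using assms by (simp add: simple_graph_def)

lemma card_edge:
  assumes "simple_graph H" "e \<in> edges H"
  shows "card e = 2"
  using assms by (auto simp: simple_graph_def nsets_def)

lemma Union_edges_subset_verts:
  assumes "simple_graph H"
  shows "\<Union>(edges H) \<subseteq> verts H"
  using assms by (auto simp: simple_graph_def nsets_def)

lemma Union_matching_subset_verts:
  assumes "simple_graph H" "matching H M"
  shows "\<Union>M \<subseteq> verts H"
  using assms Union_edges_subset_verts by (fastforce simp: matching_def)

lemma finite_Union_matching:
  assumes "simple_graph H" "matching H M"
  shows "finite (\<Union>M)"
  using Union_matching_subset_verts[OF assms] finite_verts[OF assms(1)] by (rule finite_subset)

lemma card_Union_uniform: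
  assumes "finite (\<Union>M)" "pairwise disjnt M" "\<And>e. e \<in> M \<Longrightarrow> card e = c"
  shows "card (\<Union>M) = c * card M"
  using assms by (intro card_partition[symmetric] finite_UnionD)
    (auto simp: pairwise_def disjnt_def)

lemma card_Union_matching:
  assumes "simple_graph H" "matching H M"
  shows "card (\<Union>M) = 2 * card M"
  using finite_Union_matching[OF assms]
proof (rule card_Union_uniform)
  show "pairwise disjnt M" "\<And>e. e \<in> M \<Longrightarrow> card e = 2"
    using assms(2) card_edge[OF assms(1)] by (auto simp: matching_def)
qed

lemma matching_number_ge:
  assumes "simple_graph H" "matching H M"
  shows "card M \<le> matching_number H"
  unfolding matching_number_def using assms by (intro Max_ge) (auto simp: finite_matchings)

lemma obtain_maximum_matching:
  assumes "simple_graph H"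
  obtains M where "matching H M" "card M = matching_number H"
proof -
  have "matching H {}" by (simp add: matching_def)
  then have "matching_number H \<in> card ` {M. matching H M}"
    unfolding matching_number_def using assms by (intro Max_in) (auto simp: finite_matchings)
  then show ?thesis using that by auto
qed

lemma matching_number_le_half_Union_edges:
  assumes "simple_graph H"
  shows "2 * matching_number H \<le> card (\<Union>(edges H))"
proof -
  obtain M where M: "matching H M" "card M = matching_number H"
    using obtain_maximum_matching[OF assms] .
  have "finite (\<Union>(edges H))"
    using Union_edges_subset_verts[OF assms] finite_verts[OF assms] by (rule finite_subset)
  then have "card (\<Union>M) \<le> card (\<Union>(edges H))"
    using M(1) by (intro card_mono) (auto simp: matching_def)
  then show ?thesis using card_Union_matching[OF assms M(1)] M(2) by simp
qed

lemma card_involution_le_matching_number: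
  assumes "simple_graph H"
    and edge: "\<And>x. x \<in> S \<Longrightarrow> {x, f x} \<in> edges H"
    and closed: "\<And>x. x \<in> S \<Longrightarrow> f x \<in> S"
    and involution: "\<And>x. x \<in> S \<Longrightarrow> f (f x) = x"
  shows "card S \<le> 2 * matching_number H"
proof -
  define P where "P = (\<lambda>x. {x, f x}) ` S"
  have pair_eq: "{x, f x} = {z, f z}" if "x \<in> S" "z \<in> {x, f x}" for x z
    using that involution[OF that(1)] by (elim insertE emptyE) (simp_all add: insert_commute)
  have "pairwise disjnt P"
  proof (rule pairwiseI)
    fix p q assume "p \<in> P" "q \<in> P" "p \<noteq> q"
    then obtain x y where "x \<in> S" "p = {x, f x}" "y \<in> S" "q = {y, f y}" by (auto simp: P_def)
    then show "disjnt p q" using pair_eq[of x] pair_eq[of y] \<open>p \<noteq> q\<close> unfolding disjnt_iff by metis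
  qed
  then have matching: "matching H P" using edge by (auto simp: matching_def P_def)
  have "\<Union>P = S" using closed by (auto simp: P_def)
  then have "card S = 2 * card P" using card_Union_matching[OF assms(1) matching] by simp
  then show ?thesis using matching_number_ge[OF assms(1) matching] by simp
qed

definition crossing :: "'a set set \<Rightarrow> 'a set \<Rightarrow> 'a set set" where
  "crossing M A = {e \<in> M. \<not> e \<subseteq> A \<and> \<not> disjnt e A}"

definition crossed_nsets :: "'a set set \<Rightarrow> 'a set \<Rightarrow> nat \<Rightarrow> 'a set set" where
  "crossed_nsets M V k = {A \<in> [V]\<^bsup>k\<^esup>. crossing M A \<noteq> {}}"

definition uncrossed_nsets :: "'a set set \<Rightarrow> 'a set \<Rightarrow> nat \<Rightarrow> 'a set set" where
  "uncrossed_nsets M V k = {A \<in> [V]\<^bsup>k\<^esup>. crossing M A = {}}"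

lemma card_crossed_nsets_plus_uncrossed_nsets:
  assumes "finite V"
  shows "card (crossed_nsets M V k) + card (uncrossed_nsets M V k) = card V choose k"
proof -
  have "crossed_nsets M V k \<union> uncrossed_nsets M V k = [V]\<^bsup>k\<^esup>"
    by (auto simp: crossed_nsets_def uncrossed_nsets_def)
  moreover have "crossed_nsets M V k \<inter> uncrossed_nsets M V k = {}"
    by (auto simp: crossed_nsets_def uncrossed_nsets_def)
  moreover have "finite ([V]\<^bsup>k\<^esup>)" using assms by (rule finite_imp_finite_nsets)
  ultimately show ?thesis by (metis card_Un_disjoint card_nsets finite_Un)
qed

lemma crossing_sym_diff:
  assumes "pairwise disjnt M" "e \<in> M"
  shows "crossing M (sym_diff A e) = crossing M A"
proof -
  have "\<not> d \<subseteq> sym_diff A e \<and> \<not> disjnt d (sym_diff A e) \<longleftrightarrow> \<not> d \<subseteq> A \<and> \<not> disjnt d A"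
    if "d \<in> M" for d
  proof (cases "d = e")
    case True
    then show ?thesis by (auto simp: disjnt_def)
  next
    case False
    then have "d \<inter> e = {}" using assms that by (auto simp: pairwise_def disjnt_def)
    then show ?thesis unfolding disjnt_def by blast
  qed
  then show ?thesis unfolding crossing_def by blast
qed

lemma card_sym_diff_crossing:
  assumes "e \<in> crossing M A" "card e = 2" "finite A"
  shows "card (sym_diff A e) = card A"
proof -
  obtain x y where xy: "e = {x, y}" "x \<in> A" "y \<notin> A"
    using assms(1,2) by (auto simp: crossing_def card_2_iff disjnt_def)
  then have "sym_diff A e = insert y (A - {x})" by auto
  then have "card (sym_diff A e) = Suc (card (A - {x}))" using xy assms(3) by simp
  also have "\<dots> = card A" by (rule card_Suc_Diff1[OF assms(3) xy(2)])
  finally show ?thesis .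
qed

lemma sym_diff_mem_crossing:
  assumes "sym_diff A B \<in> M" "A \<noteq> B" "card A = card B" "finite A" "finite B"
  shows "sym_diff A B \<in> crossing M A"
proof -
  have "\<not> A \<subset> B" "\<not> B \<subset> A"
    using psubset_card_mono[of B A] psubset_card_mono[of A B] assms by auto
  then show ?thesis using assms(1,2) unfolding crossing_def disjnt_def by blast
qed

lemma sym_diff_crossing_in_nsets:
  assumes "simple_graph G" "A \<in> [verts G]\<^bsup>k\<^esup>" "e \<in> crossing (edges G) A"
  shows "sym_diff A e \<in> [verts G]\<^bsup>k\<^esup>"
proof -
  have e: "e \<in> edges G" using assms(3) by (simp add: crossing_def)
  have A: "A \<subseteq> verts G" "finite A" "card A = k" using assms(2) by (auto simp: nsets_def)
  have "card e = 2" using assms(1) e by (rule card_edge)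
  then have "card (sym_diff A e) = k" "finite (sym_diff A e)"
    using card_sym_diff_crossing[OF assms(3)] A by (simp_all add: card_ge_0_finite)
  moreover have "sym_diff A e \<subseteq> verts G"
    using A(1) e Union_edges_subset_verts[OF assms(1)] by blast
  ultimately show ?thesis by (simp add: nsets_def)
qed

lemma token_graph_edge_crossing:
  assumes "simple_graph G" "A \<in> [verts G]\<^bsup>k\<^esup>" "e \<in> crossing (edges G) A"
  shows "{A, sym_diff A e} \<in> edges (token_graph k G)"
proof -
  have "sym_diff A (sym_diff A e) = e" by blast
  with assms(3) have "sym_diff A (sym_diff A e) \<in> edges G" by (simp add: crossing_def)
  with assms(2) sym_diff_crossing_in_nsets[OF assms] show ?thesis
    unfolding token_graph_def by auto
qed

lemma Union_edges_token_graph: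
  assumes "simple_graph G"
  shows "\<Union>(edges (token_graph k G)) = crossed_nsets (edges G) (verts G) k"
proof
  show "\<Union>(edges (token_graph k G)) \<subseteq> crossed_nsets (edges G) (verts G) k"
  proof
    fix A assume "A \<in> \<Union>(edges (token_graph k G))"
    then obtain B where AB: "A \<in> [verts G]\<^bsup>k\<^esup>" "B \<in> [verts G]\<^bsup>k\<^esup>" "sym_diff A B \<in> edges G"
      by (auto simp: token_graph_def Un_commute)
    have "A \<noteq> B" using card_edge[OF assms AB(3)] by auto
    then have "sym_diff A B \<in> crossing (edges G) A"
      using AB by (intro sym_diff_mem_crossing) (auto simp: nsets_def)
    then show "A \<in> crossed_nsets (edges G) (verts G) k"
      using AB(1) by (auto simp: crossed_nsets_def)
  qed
  show "crossed_nsets (edges G) (verts G) k \<subseteq> \<Union>(edges (token_graph k G))"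
    using token_graph_edge_crossing[OF assms] by (fastforce simp: crossed_nsets_def)
qed

lemma card_crossed_nsets_le_matching_number_token_graph:
  assumes G: "simple_graph G" and M: "matching G M"
  shows "card (crossed_nsets M (verts G) k) \<le> 2 * matching_number (token_graph k G)"
proof -
  define chosen where "chosen A = (SOME e. e \<in> crossing M A)" for A
  define move where "move A = sym_diff A (chosen A)" for A
  have chosen: "chosen A \<in> crossing M A" if "A \<in> crossed_nsets M (verts G) k" for A
    using that unfolding chosen_def crossed_nsets_def by (auto intro: someI)
  have crossing_move: "crossing M (move A) = crossing M A"
    if "A \<in> crossed_nsets M (verts G) k" for A
    using M chosen[OF that] unfolding move_def
    by (intro crossing_sym_diff) (auto simp: matching_def crossing_def)
  show ?thesis
  proof (rule card_involution_le_matching_number[OF simple_graph_token_graph[OF G]])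
    fix A assume A: "A \<in> crossed_nsets M (verts G) k"
    have edge: "A \<in> [verts G]\<^bsup>k\<^esup>" "chosen A \<in> crossing (edges G) A"
      using A chosen[OF A] M by (auto simp: crossed_nsets_def crossing_def matching_def)
    show "{A, move A} \<in> edges (token_graph k G)"
      unfolding move_def by (rule token_graph_edge_crossing[OF G edge])
    have "move A \<in> [verts G]\<^bsup>k\<^esup>"
      unfolding move_def by (rule sym_diff_crossing_in_nsets[OF G edge])
    then show "move A \<in> crossed_nsets M (verts G) k"
      using crossing_move[OF A] A by (simp add: crossed_nsets_def)
    have "chosen (move A) = chosen A" by (simp add: chosen_def crossing_move[OF A])
    then show "move (move A) = A" by (auto simp: move_def)
  qed
qed

lemma matching_number_token_graph_le_crossed_nsets:
  assumes "simple_graph G"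
  shows "2 * matching_number (token_graph k G) \<le> card (crossed_nsets (edges G) (verts G) k)"
  using matching_number_le_half_Union_edges[OF simple_graph_token_graph[OF assms]]
  by (simp add: Union_edges_token_graph[OF assms])

lemma matching_number_token_graph_disjoint_edges:
  assumes "simple_graph G" "pairwise disjnt (edges G)"
  shows "2 * matching_number (token_graph k G) = card (crossed_nsets (edges G) (verts G) k)"
proof (rule antisym)
  show "2 * matching_number (token_graph k G) \<le> card (crossed_nsets (edges G) (verts G) k)"
    using assms(1) by (rule matching_number_token_graph_le_crossed_nsets)
  show "card (crossed_nsets (edges G) (verts G) k) \<le> 2 * matching_number (token_graph k G)"
    using assms by (intro card_crossed_nsets_le_matching_number_token_graph)
      (simp_all add: matching_def)
qed

lemma uncrossed_eq_Union:
  assumes "crossing M A = {}"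
  shows "\<Union>{e \<in> M. e \<subseteq> A} \<union> (A - \<Union>M) = A"
  using assms by (auto simp: crossing_def disjnt_def)

lemma Collect_subset_Union_Un:
  assumes "pairwise disjnt M" "{} \<notin> M" "N \<subseteq> M" "R \<inter> \<Union>M = {}"
  shows "{e \<in> M. e \<subseteq> \<Union>N \<union> R} = N"
proof
  show "{e \<in> M. e \<subseteq> \<Union>N \<union> R} \<subseteq> N"
  proof clarify
    fix e assume e: "e \<in> M" "e \<subseteq> \<Union>N \<union> R"
    then obtain x where "x \<in> e" using assms(2) by (metis ex_in_conv)
    then obtain d where "d \<in> N" "x \<in> d" using e assms(4) by blast
    then have "d = e" using \<open>x \<in> e\<close> e(1) assms(1,3) by (auto simp: pairwise_def disjnt_def)
    then show "e \<in> N" using \<open>d \<in> N\<close> by simp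
  qed
  show "N \<subseteq> {e \<in> M. e \<subseteq> \<Union>N \<union> R}" using assms(3) by blast
qed

lemma crossing_Union_Un_eq_empty:
  assumes "pairwise disjnt M" "N \<subseteq> M" "R \<inter> \<Union>M = {}"
  shows "crossing M (\<Union>N \<union> R) = {}"
proof -
  have "disjnt e (\<Union>N \<union> R)" if e: "e \<in> M" "e \<notin> N" for e
  proof -
    have "disjnt e d" if "d \<in> N" for d
      using that e assms(2) by (intro pairwiseD[OF assms(1)]) auto
    then show ?thesis using e(1) assms(3) by (auto simp: disjnt_def)
  qed
  then show ?thesis by (auto simp: crossing_def)
qed

lemma bij_betw_uncrossed_subsets:
  assumes "pairwise disjnt M" "{} \<notin> M" "\<Union>M \<subseteq> V"
  shows "bij_betw (\<lambda>(N, R). \<Union>N \<union> R) (Pow M \<times> Pow (V - \<Union>M)) {A. A \<subseteq> V \<and> crossing M A = {}}"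
    (is "bij_betw ?union ?D ?U")
proof (rule bij_betw_byWitness[where f' = "\<lambda>A. ({e \<in> M. e \<subseteq> A}, A - \<Union>M)"])
  have inverse: "({e \<in> M. e \<subseteq> \<Union>N \<union> R}, \<Union>N \<union> R - \<Union>M) = (N, R)"
    and uncrossed: "\<Union>N \<union> R \<in> ?U" if "N \<subseteq> M" "R \<subseteq> V - \<Union>M" for N R
  proof -
    have R: "R \<inter> \<Union>M = {}" using that(2) by blast
    have "\<Union>N \<union> R - \<Union>M = R" using that by blast
    then show "({e \<in> M. e \<subseteq> \<Union>N \<union> R}, \<Union>N \<union> R - \<Union>M) = (N, R)"
      using Collect_subset_Union_Un[OF assms(1,2) that(1) R] by simp
    have "\<Union>N \<union> R \<subseteq> V" using that assms(3) by blast
    then show "\<Union>N \<union> R \<in> ?U" using crossing_Union_Un_eq_empty[OF assms(1) that(1) R] by simp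
  qed
  show "\<forall>p \<in> ?D. ({e \<in> M. e \<subseteq> ?union p}, ?union p - \<Union>M) = p"
  proof
    fix p assume "p \<in> ?D"
    then obtain N R where "p = (N, R)" "N \<subseteq> M" "R \<subseteq> V - \<Union>M" by blast
    with inverse[of N R] show "({e \<in> M. e \<subseteq> ?union p}, ?union p - \<Union>M) = p" by simp
  qed
  show "?union ` ?D \<subseteq> ?U"
  proof (rule image_subsetI)
    fix p assume "p \<in> ?D"
    then obtain N R where "p = (N, R)" "N \<subseteq> M" "R \<subseteq> V - \<Union>M" by blast
    with uncrossed[of N R] show "?union p \<in> ?U" by simp
  qed
  show "\<forall>A \<in> ?U. ?union ({e \<in> M. e \<subseteq> A}, A - \<Union>M) = A"
    by (simp add: uncrossed_eq_Union)
  show "(\<lambda>A. ({e \<in> M. e \<subseteq> A}, A - \<Union>M)) ` ?U \<subseteq> ?D" by auto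
qed

lemma card_Union_Un_eq_iff_div_mod:
  assumes "finite V" "\<Union>M \<subseteq> V" "pairwise disjnt M" "\<And>e. e \<in> M \<Longrightarrow> card e = c"
    and "card (V - \<Union>M) < c" "N \<subseteq> M" "R \<subseteq> V - \<Union>M"
  shows "card (\<Union>N \<union> R) = k \<longleftrightarrow> card N = k div c \<and> card R = k mod c"
proof -
  have finite: "finite (\<Union>N)" "finite R" using assms(1,2,6,7) by (auto intro: finite_subset)
  then have "card (\<Union>N \<union> R) = card (\<Union>N) + card R"
    using assms(6,7) by (intro card_Un_disjoint) auto
  also have "card (\<Union>N) = c * card N"
    using finite(1) pairwise_subset[OF assms(3,6)] assms(4,6) by (intro card_Union_uniform) auto
  finally have "card (\<Union>N \<union> R) = c * card N + card R" .
  moreover have "card R < c"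
    using assms(1,5,7) by (meson card_mono finite_Diff le_less_trans)
  ultimately show ?thesis by auto
qed

lemma card_uncrossed_nsets:
  assumes V: "finite V" "\<Union>M \<subseteq> V"
    and M: "pairwise disjnt M" "\<And>e. e \<in> M \<Longrightarrow> card e = c"
    and few: "card (V - \<Union>M) < c"
  shows "card (uncrossed_nsets M V k)
    = (card M choose (k div c)) * (card (V - \<Union>M) choose (k mod c))"
proof -
  let ?union = "\<lambda>(N, R). \<Union>N \<union> R"
  let ?D = "nsets M (k div c) \<times> nsets (V - \<Union>M) (k mod c)"
  have finite_sets: "finite M" "\<And>A. A \<subseteq> V \<Longrightarrow> finite A"
    using V by (meson finite_UnionD finite_subset)+
  have D_eq: "?D = {(N, R) \<in> Pow M \<times> Pow (V - \<Union>M). card (\<Union>N \<union> R) = k}"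
    using card_Union_Un_eq_iff_div_mod[OF V M few] finite_sets
    by (auto simp: nsets_def intro: finite_subset)
  have "{} \<notin> M" using M(2) few by fastforce
  note bij = bij_betw_uncrossed_subsets[OF M(1) this V(2)]
  have bij_D: "bij_betw ?union ?D (uncrossed_nsets M V k)"
  proof (rule bij_betw_subset[OF bij])
    show "?D \<subseteq> Pow M \<times> Pow (V - \<Union>M)" by (auto simp: nsets_def)
    have "uncrossed_nsets M V k = {A \<in> ?union ` (Pow M \<times> Pow (V - \<Union>M)). card A = k}"
      using finite_sets(2) unfolding bij_betw_imp_surj_on[OF bij]
      by (auto simp: uncrossed_nsets_def nsets_def)
    then show "?union ` ?D = uncrossed_nsets M V k" unfolding D_eq by auto
  qed
  show ?thesis
    unfolding bij_betw_same_card[OF bij_D, symmetric]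
    by (simp add: card_cartesian_product card_nsets)
qed

lemma card_uncrossed_nsets_matching:
  assumes "simple_graph G" "matching G M" "card M = card (verts G) div 2"
  shows "card (uncrossed_nsets M (verts G) k)
    = (card (verts G) div 2 choose (k div 2)) * (card (verts G) mod 2 choose (k mod 2))"
proof -
  note subset = Union_matching_subset_verts[OF assms(1,2)]
  have "card (verts G - \<Union>M) = card (verts G) - 2 * (card (verts G) div 2)"
    using card_Diff_subset[OF finite_Union_matching[OF assms(1,2)] subset]
      card_Union_matching[OF assms(1,2)] assms(3) by simp
  then have missed: "card (verts G - \<Union>M) = card (verts G) mod 2"
    by (simp add: minus_mult_div_eq_mod)
  have "pairwise disjnt M" "\<And>e. e \<in> M \<Longrightarrow> card e = 2"
    using assms(2) card_edge[OF assms(1)] by (auto simp: matching_def)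
  from card_uncrossed_nsets[OF finite_verts[OF assms(1)] subset this, of k] show ?thesis
    using missed assms(3) by simp
qed

lemma matching_number_token_graph_ge:
  assumes "simple_graph G" "matching_number G = card (verts G) div 2"
  shows "card (verts G) choose k \<le> 2 * matching_number (token_graph k G)
    + (card (verts G) div 2 choose (k div 2)) * (card (verts G) mod 2 choose (k mod 2))"
proof -
  obtain M where M: "matching G M" "card M = card (verts G) div 2"
    using obtain_maximum_matching[OF assms(1)] assms(2) by metis
  have "card (verts G) choose k
    = card (crossed_nsets M (verts G) k) + card (uncrossed_nsets M (verts G) k)"
    using finite_verts[OF assms(1)] by (rule card_crossed_nsets_plus_uncrossed_nsets[symmetric])
  also have "\<dots> \<le> 2 * matching_number (token_graph k G) + card (uncrossed_nsets M (verts G) k)"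
    by (intro add_right_mono card_crossed_nsets_le_matching_number_token_graph[OF assms(1) M(1)])
  finally show ?thesis unfolding card_uncrossed_nsets_matching[OF assms(1) M] .
qed

lemma matching_number_token_graph_eq:
  assumes "simple_graph G" "pairwise disjnt (edges G)" "card (edges G) = card (verts G) div 2"
  shows "card (verts G) choose k = 2 * matching_number (token_graph k G)
    + (card (verts G) div 2 choose (k div 2)) * (card (verts G) mod 2 choose (k mod 2))"
proof -
  have matching: "matching G (edges G)" using assms(2) by (simp add: matching_def)
  have "card (verts G) choose k
    = card (crossed_nsets (edges G) (verts G) k) + card (uncrossed_nsets (edges G) (verts G) k)"
    using finite_verts[OF assms(1)] by (rule card_crossed_nsets_plus_uncrossed_nsets[symmetric])
  then show ?thesis
    unfolding matching_number_token_graph_disjoint_edges[OF assms(1,2)]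
      card_uncrossed_nsets_matching[OF assms(1) matching assms(3)] .
qed

lemma matching_number_token_graph_le:
  assumes "simple_graph G"
  shows "2 * matching_number (token_graph k G) \<le> card (verts G) choose k"
  using matching_number_token_graph_le_crossed_nsets[OF assms, of k]
    card_crossed_nsets_plus_uncrossed_nsets[OF finite_verts[OF assms], of "edges G" k]
  by linarith

lemma odd_pred_div_2:
  fixes n :: nat
  assumes "odd n"
  shows "(n - 1) div 2 = n div 2"
  using assms by presburger

lemma edges_perfect_or_almost_perfect:
  assumes "is_perfect_matching G \<or> is_almost_perfect_matching G"
  shows "pairwise disjnt (edges G)" "card (edges G) = card (verts G) div 2"
  using assms odd_pred_div_2[of "card (verts G)"]
  unfolding is_perfect_matching_def is_almost_perfect_matching_def by (blast, metis)

lemma binomial_mod_2: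
  "n mod 2 choose (k mod 2) = (if even n \<and> odd k then 0 else 1)"
  by (cases "even n"; cases "even k") (simp_all add: odd_iff_mod_2_eq_one even_iff_mod_2_eq_zero)

theorem theorem1p1:
  fixes G :: "'a ugraph" and n k :: nat
  assumes "simple_graph G"
    and "card (verts G) = n"
    and "1 \<le> k" and "k \<le> n - 1"
    and "matching_number G = n div 2"
  shows
    "(even n \<and> odd k \<longrightarrow>
        real (matching_number (token_graph k G)) = real (n choose k) / 2) \<and>
     (even n \<and> even k \<longrightarrow>
        real (matching_number (token_graph k G)) \<ge>
          (real (n choose k) - real ((n div 2) choose (k div 2))) / 2) \<and>
     (odd n \<longrightarrow>
        real (matching_number (token_graph k G)) \<ge>
          (real (n choose k) - real (((n - 1) div 2) choose (k div 2))) / 2) \<and>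
     (is_perfect_matching G \<and> even k \<longrightarrow>
        real (matching_number (token_graph k G)) =
          (real (n choose k) - real ((n div 2) choose (k div 2))) / 2) \<and>
     (is_almost_perfect_matching G \<longrightarrow>
        real (matching_number (token_graph k G)) =
          (real (n choose k) - real (((n - 1) div 2) choose (k div 2))) / 2)"
proof -
  let ?\<nu> = "matching_number (token_graph k G)"
  let ?b = "(n div 2 choose (k div 2)) * (n mod 2 choose (k mod 2))"
  have upper: "2 * ?\<nu> \<le> n choose k"
    using matching_number_token_graph_le[OF assms(1)] assms(2) by simp
  have lower: "n choose k \<le> 2 * ?\<nu> + ?b"
    using matching_number_token_graph_ge[OF assms(1)] assms(2,5) by simp
  have exact: "n choose k = 2 * ?\<nu> + ?b"
    if "is_perfect_matching G \<or> is_almost_perfect_matching G"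
    using matching_number_token_graph_eq[OF assms(1)] assms(2)
      edges_perfect_or_almost_perfect[OF that] by simp
  have odd: "odd n" if "is_almost_perfect_matching G"
    using that assms(2) by (simp add: is_almost_perfect_matching_def)
  show ?thesis
  proof (cases "even n \<and> odd k")
    case True
    then have "?b = 0" unfolding binomial_mod_2 by simp
    then have "2 * ?\<nu> = n choose k" using upper lower by linarith
    then show ?thesis using True odd by auto
  next
    case False
    then have b_eq: "?b = n div 2 choose (k div 2)" unfolding binomial_mod_2 by auto
    show ?thesis
      using lower[unfolded b_eq] exact[unfolded b_eq] odd_pred_div_2[of n] odd False by auto
  qed
qed

end
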